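(* Let $F$ be a field and let $f(x)=a_nx^n+a_{n-1}x^{n-1}+\ldots+a_2x^2+a_1x+a_0$ and $g(x)=b_mx^m-b_{m-1}x^{m-1}-\ldots-b_2x^2-b_1x-b_0$, where $a_n\neq0$ and $b_m\neq0$, be polynomials in $F[x]$, and suppose that $m\le n$. Then the remainder on dividing $f(x)$ by $g(x)$ is $$r(x)=\sum_{k=0}^{m-1}\left(a_k+\frac{1}{b_m}\sum_{i+j=k}b_i\sum_{\nu=0}^{n-m-j}t_{n-m-j+1-\nu}\,a_{n-\nu}\right)x^k,$$ where the sum over $i+j=k$ runs over $i=0,1,\ldots,m$ and $j=0,1,\ldots,n-m$ with $i+j=k$, and $\{t_r\}$ is the linear recurrent sequence given by $t_1=\frac{1}{b_m}$ and $t_r=\frac{1}{b_m}\sum_{i=1}^{r-1}b_{m-i}t_{r-i}$ for $r=2,3,\ldots$.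
   Context: The remainder on dividing $f(x)$ by a nonzero polynomial $g(x)\in F[x]$ is the unique $r(x)\in F[x]$ such that $f(x)=g(x)q(x)+r(x)$ for some $q(x)\in F[x]$, with $r(x)=0$ or $\deg r(x)<\deg g(x)$. Convention: $b_i=0$ when the index $i$ is negative.
   Formalization: The initial value is taken as t_1 = 1 instead of t_1 = 1/b_m, since the printed formula counts the factor 1/b_m twice: for f = x, g = 2x − 1 it gives 1/4, whereas the remainder is 1/2. *)

theory Defs
  imports "HOL-Computational_Algebra.Polynomial"
begin

(* Correction to the printed source, which takes t 1 = 1 / b m.  With that value the
   correction term of the remainder formula carries the factor 1 / b m twice: for
   f = x and g = 2 * x - 1 it yields 1/4 instead of 1/2.  The initial value is therefore
   t 1 = 1, as obtained by applying the monic case to g / b m; equivalently, one could keep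
   t 1 = 1 / b m and drop the factor 1 / b m in front of the sum over i + j = k.
   The recurrence itself is unchanged; its conditional expresses the convention that b has
   value 0 at negative indices. *)
definition remainder_seq :: "nat \<Rightarrow> (nat \<Rightarrow> 'a :: field) \<Rightarrow> (nat \<Rightarrow> 'a) \<Rightarrow> bool" where
  "remainder_seq m b t \<longleftrightarrow>
     t 1 = 1 \<and>
     (\<forall>r\<ge>2. t r = 1 / b m * (\<Sum>i = 1..r - 1. (if i \<le> m then b (m - i) else 0) * t (r - i)))"

end

theory Submission
  imports Defs "HOL-Computational_Algebra.Formal_Power_Series"
begin

text \<open>
  Division of polynomials becomes division of formal power series once the coefficients are read
  from the top down. Write \<open>G\<close> for \<open>g\<close> with reversed coefficients and divided by \<open>b m\<close>, so that
  \<open>G\<close> has constant term 1, and \<open>A\<close> for the reversal of \<open>f\<close>. The recurrence for \<open>t\<close> says that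
  \<open>T = (\<Sum>r. t (r + 1) X\<^sup>r)\<close> is the inverse of \<open>G\<close> (\<open>reversed_divisor_inverse\<close>). Hence \<open>P = A T\<close>
  solves \<open>G P = A\<close>, and the first \<open>n - m + 1\<close> coefficients of \<open>P\<close>, reversed again and divided by
  \<open>b m\<close>, are the coefficients of a polynomial \<open>q\<close>. The coefficient of \<open>P\<close> at
  \<open>n - m - j\<close>, which belongs to \<open>X\<^sup>j\<close> in \<open>q\<close>, is the inner sum of the remainder formula.

  In degrees up to \<open>n - m\<close>, the equation \<open>G P = A\<close> says precisely that \<open>g q\<close> and \<open>f\<close> agree in
  the degrees from \<open>m\<close> to \<open>n\<close> (\<open>coeff_mult_reversed\<close>), and above \<open>n\<close> both vanish. Therefore
  \<open>f - g q\<close> is zero or has degree below \<open>m\<close>, and is the remainder; its coefficients in degree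
  \<open>k < m\<close> are read off from the product \<open>g q\<close>, where the lower coefficients of \<open>g\<close> are \<open>- b i\<close>.
\<close>

text \<open>
  Comparing coefficients at \<open>X\<^sup>r\<close> with \<open>r > 0\<close> in this product gives the recurrence for
  \<open>t (r + 1)\<close>; the initial value \<open>t 1 = 1\<close> is the constant term.
\<close>

lemma reversed_divisor_inverse:
  fixes b t :: "nat \<Rightarrow> 'a :: field"
  assumes "remainder_seq m b t"
  shows "Abs_fps (\<lambda>e. if e = 0 then 1 else if e \<le> m then - b (m - e) / b m else 0) *
         Abs_fps (\<lambda>r. t (Suc r)) = 1" (is "Abs_fps ?c * Abs_fps ?t = 1")
proof (rule fps_ext)
  fix r
  show "fps_nth (Abs_fps ?c * Abs_fps ?t) r = fps_nth 1 r"
  proof (cases "r = 0")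
    case True
    then show ?thesis using assms by (simp add: remainder_seq_def)
  next
    case False
    then have "\<forall>r\<ge>2. t r = 1 / b m *
        (\<Sum>i = 1..r - 1. (if i \<le> m then b (m - i) else 0) * t (r - i))" and "2 \<le> Suc r"
      using assms by (auto simp: remainder_seq_def)
    then have "t (Suc r) = 1 / b m *
        (\<Sum>i = 1..r. (if i \<le> m then b (m - i) else 0) * t (Suc r - i))"
      by (fastforce dest: spec[of _ "Suc r"])
    also have "\<dots> = - (\<Sum>i = 1..r. ?c i * t (Suc (r - i)))"
      unfolding sum_distrib_left sum_negf[symmetric]
      by (rule sum.cong) (auto simp: Suc_diff_le)
    finally show ?thesis
      using False by (simp add: fps_mult_nth sum.atLeast_Suc_atMost)
  qed
qed

text \<open>
  A product of polynomials, read from the top down, is a Cauchy product: if \<open>q\<close> is the reversal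
  of an initial segment of \<open>p\<close>, then truncating \<open>p\<close> does not affect degrees \<open>k \<ge> m\<close>, because these
  involve \<open>p\<close> only up to the index \<open>n - k\<close>.
\<close>

lemma coeff_mult_reversed:
  fixes g q :: "'a :: comm_semiring_1 poly"
  assumes g: "\<And>i. coeff g i = (if i \<le> m then c (m - i) else 0)"
    and q: "\<And>j. coeff q j = (if j \<le> n - m then p (n - m - j) else 0)"
    and c: "\<And>e. m < e \<Longrightarrow> c e = 0"
    and "m \<le> k" "k \<le> n"
  shows "coeff (g * q) k = (\<Sum>e = 0..n - k. c e * p (n - k - e))"
proof -
  have "coeff (g * q) k = (\<Sum>i | i \<le> k \<and> i \<le> m \<and> k - i \<le> n - m. coeff g i * coeff q (k - i))"
    unfolding coeff_mult by (rule sum.mono_neutral_right) (auto simp: g q)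
  also have "\<dots> = (\<Sum>e | e \<le> m \<and> e \<le> n - k. c e * p (n - k - e))"
    by (rule sum.reindex_bij_witness[where i = "\<lambda>e. m - e" and j = "\<lambda>i. m - i"])
       (use assms(4,5) in \<open>auto simp: g q algebra_simps\<close>)
  also have "\<dots> = (\<Sum>e = 0..n - k. c e * p (n - k - e))"
    by (rule sum.mono_neutral_left) (auto, metis c linorder_not_le mult_zero_left)
  finally show ?thesis .
qed

theorem theorem3p1:
  fixes a b t :: "nat \<Rightarrow> 'a :: field" and m n :: nat and f g :: "'a poly"
  assumes "f = (\<Sum>i\<le>n. monom (a i) i)"
    and "g = monom (b m) m - (\<Sum>i<m. monom (b i) i)"
    and "a n \<noteq> 0" and "b m \<noteq> 0"
    and "m \<le> n"
    and "remainder_seq m b t"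
  shows "f mod g =
    (\<Sum>k<m. monom
       (a k + 1 / b m *
         (\<Sum>(i, j) \<in> {(i, j). i \<le> m \<and> j \<le> n - m \<and> i + j = k}.
            b i * (\<Sum>\<nu> = 0..n - m - j. t (n - m - j + 1 - \<nu>) * a (n - \<nu>)))) k)"
    (is "_ = ?r")
proof -
  define c where "c = (\<lambda>e. if e = 0 then 1 else if e \<le> m then - b (m - e) / b m else 0)"
  \<comment> \<open>Truncated subtraction makes the coefficients of \<open>A\<close> beyond \<open>n\<close> equal to \<open>a 0\<close>; this is
    harmless, since only indices up to \<open>n - m\<close> matter below.\<close>
  define A where "A = Abs_fps (\<lambda>\<nu>. a (n - \<nu>))"
  define T where "T = Abs_fps (\<lambda>r. t (Suc r))"
  define p where "p = fps_nth (A * T)"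
  define q where "q = (\<Sum>j\<le>n - m. monom (p (n - m - j) / b m) j)"
  define R where "R = ?r"

  have p_eq: "p s = (\<Sum>\<nu> = 0..s. t (s + 1 - \<nu>) * a (n - \<nu>))" for s
    unfolding p_def A_def T_def fps_mult_nth
    by (rule sum.cong) (auto simp: Suc_diff_le)
  have coeff_f: "coeff f k = (if k \<le> n then a k else 0)" for k
    unfolding assms(1) by (simp add: coeff_sum)
  have coeff_g: "coeff g i = (if i < m then - b i else if i = m then b m else 0)" for i
    unfolding assms(2) by (simp add: coeff_sum)
  have coeff_q: "coeff q j = (if j \<le> n - m then p (n - m - j) / b m else 0)" for j
    unfolding q_def by (simp add: coeff_sum)
  have coeff_R: "coeff R k = (if k < m then a k + 1 / b m *
       (\<Sum>(i, j) \<in> {(i, j). i \<le> m \<and> j \<le> n - m \<and> i + j = k}. b i * p (n - m - j)) else 0)" for k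
    unfolding R_def p_eq by (simp add: coeff_sum)

  have "Abs_fps c * T = 1"
    unfolding c_def T_def by (rule reversed_divisor_inverse[OF assms(6)])
  then have "Abs_fps c * (A * T) = A"
    by (simp add: mult.left_commute)
  then have "fps_nth (Abs_fps c * (A * T)) s = fps_nth A s" for s
    by (rule arg_cong)
  then have conv: "(\<Sum>e = 0..s. c e * p (s - e)) = a (n - s)" for s
    unfolding p_def fps_mult_nth[of "Abs_fps c"] by (simp add: A_def)

  have "f = g * q + R"
  proof (rule poly_eqI)
    fix k
    consider (low) "k < m" | (mid) "m \<le> k" "k \<le> n" | (high) "n < k"
      by linarith
    then show "coeff f k = coeff (g * q + R) k"
    proof cases
      case low
      have "(\<Sum>(i, j) \<in> {(i, j). i \<le> m \<and> j \<le> n - m \<and> i + j = k}. b i * p (n - m - j)) / b m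
          = - coeff (g * q) k"
        unfolding coeff_mult sum_negf[symmetric] sum_divide_distrib
        by (rule sum.reindex_bij_witness_not_neutral
              [where S' = "{}" and T' = "{i \<in> {..k}. n - m < k - i}"
                 and i = "\<lambda>i. (i, k - i)" and j = fst])
           (use low in \<open>auto simp: coeff_g coeff_q intro: finite_subset[of _ "{..k} \<times> {..k}"]\<close>)
      then show ?thesis
        using low \<open>m \<le> n\<close> by (simp add: coeff_f coeff_R)
    next
      case mid
      \<comment> \<open>The leading coefficient moves from \<open>g\<close> to \<open>q\<close>, so that the convolution identity for the
        normalized \<open>c\<close> applies.\<close>
      have "g * q = smult (inverse (b m)) g * smult (b m) q"
        using \<open>b m \<noteq> 0\<close> by simp
      also have "coeff \<dots> k = (\<Sum>e = 0..n - k. c e * p (n - k - e))"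
        by (rule coeff_mult_reversed[where m = m])
           (use mid \<open>b m \<noteq> 0\<close> in \<open>auto simp: coeff_g coeff_q c_def field_simps\<close>)
      also have "\<dots> = a k"
        using mid by (simp only: conv diff_diff_cancel)
      finally show ?thesis
        using mid by (simp add: coeff_f coeff_R)
    next
      case high
      then have "coeff g i * coeff q (k - i) = 0" for i
        using \<open>m \<le> n\<close> by (auto simp: coeff_g coeff_q)
      then have "coeff (g * q) k = 0"
        unfolding coeff_mult by (intro sum.neutral ballI)
      then show ?thesis
        using high \<open>m \<le> n\<close> by (simp add: coeff_f coeff_R)
    qed
  qed
  then have "f mod g = R mod g"
    by (simp only: mod_mult_self4)
  also have "degree g = m"
    by (rule antisym) (auto intro: degree_le le_degree simp: coeff_g \<open>b m \<noteq> 0\<close>)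
  then have "R mod g = R"
  proof (cases "R = 0")
    case False
    then have "coeff R (degree R) \<noteq> 0"
      by (simp only: leading_coeff_neq_0 not_False_eq_True)
    then show ?thesis
      using \<open>degree g = m\<close> by (intro mod_poly_less) (simp add: coeff_R split: if_splits)
  qed simp
  finally show ?thesis
    unfolding R_def .
qed

end
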